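(* There exist an arithmetic sequence $(a_n)$ and an arithmetic-type sequence $(e_n)$ corresponding to $(a_n)$ such that $(e_n)$ is strongly non $L$-invariant and not weakly $L$-invariant, but $|t^{s}_{(e_n)}(\mathbb{T})\setminus t_{(e_n)}(\mathbb{T})|=\mathfrak{c}$.
   Context: $\mathbb{N}=\{1,2,3,\dots\}$, $\mathbb{T}=\mathbb{R}/\mathbb{Z}$, $\mathfrak{c}$ is the cardinality of the continuum, $[m,n]$ denotes the set of integers $j$ with $m\le j\le n$, and $\|x\|$ denotes the distance from a real $x$ to the nearest integer (well defined on $\mathbb{T}$). For $A\subseteq\mathbb{N}$, $\overline{d}(A)=\limsup_{n\to\infty}|A\cap[0,n-1]|/n$ (upper density), $\underline{d}(A)=\liminf_{n\to\infty}|A\cap[0,n-1]|/n$, and $d(A)$ denotes the common value when they agree (natural density). An arithmetic sequence is a sequence of positive integers $1=a_0<a_1<a_2<\cdots$ with $a_n\mid a_{n+1}$ for every $n$; its ratios are $b_n=a_n/a_{n-1}$ for $n\ge 1$. Let $(d_n)$ be the increasing enumeration of the set $\{r a_k : k\ge 0,\ 1\le r<b_{k+1}\}$. An arithmetic-type sequence corresponding to $(a_n)$ is a strictly increasing sequence of integers $(e_n)_{n\in\mathbb{N}}$ such that $(a_n)$ is a subsequence of $(e_n)$ and $(e_n)$ is a subsequence of $(d_n)$. For $k\ge 0$, $n_k$ denotes the index with $e_{n_k}=a_k$ (so $n_0=1$). The lifting function $L:\mathcal{P}(\mathbb{N})\to\mathcal{P}(\mathbb{N})$ is $L(A)=\bigcup_{k\in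 A}[n_{k-1},n_k-1]$. For $m\in\mathbb{N}\cup\{0\}$, $A-m=\{n\in\mathbb{N}: n=a-m \text{ for some } a\in A\}$. A set $A\subseteq\mathbb{N}$ is $b$-divergent if it is infinite and the sequence of ratios $(b_n)_{n\in A}$ diverges to $\infty$. The sequence $(e_n)$ is strongly non $L$-invariant if $\overline{d}(L(A))>0$ for every $b$-divergent $A\subseteq\mathbb{N}$. It is weakly $L$-invariant if there exists an infinite $A\subseteq\mathbb{N}$ such that $d(L(A-m))=0$ for each $m\in\mathbb{N}\cup\{0\}$. The characterized subgroup is $t_{(e_n)}(\mathbb{T})=\{x\in\mathbb{T}: e_nx\to 0 \text{ in } \mathbb{T}\}$. The statistically characterized subgroup is $t^s_{(e_n)}(\mathbb{T})=\{x\in\mathbb{T}: e_nx\to 0 \text{ statistically}\}$, i.e. the set of $x\in\mathbb{T}$ such that $d(\{n\in\mathbb{N}:\|e_nx\|\ge\varepsilon\})=0$ for every $\varepsilon>0$. *)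

theory Defs
  imports Complex_Main "HOL-Library.Infinite_Set" "HOL-Library.Liminf_Limsup"
    "HOL-Library.Extended_Real" "HOL-Library.Equipollence"
begin

text \<open>
  Sequences and subsets indexed by the positive integers are represented over \<^typ>\<open>nat\<close>
  with index set \<open>{1..}\<close>; a value at index \<open>0\<close> of such a sequence is never inspected.
\<close>

definition dist_nearest_int :: "real \<Rightarrow> real" where
  "dist_nearest_int x = \<bar>x - of_int (round x)\<bar>"

lemma dist_nearest_int_le: "dist_nearest_int x \<le> \<bar>x - of_int m\<bar>"
  unfolding dist_nearest_int_def by (rule round_diff_minimal)

lemma dist_nearest_int_shift: "dist_nearest_int (x + of_int m) = dist_nearest_int x"
proof (rule antisym)
  show "dist_nearest_int (x + of_int m) \<le> dist_nearest_int x"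
    using dist_nearest_int_le[of "x + of_int m" "round x + m"] by (simp add: dist_nearest_int_def)
  show "dist_nearest_int x \<le> dist_nearest_int (x + of_int m)"
    using dist_nearest_int_le[of x "round (x + of_int m) - m"]
    by (simp add: dist_nearest_int_def algebra_simps)
qed

lemma dist_nearest_int_cong: "x - y \<in> \<int> \<Longrightarrow> dist_nearest_int x = dist_nearest_int y"
  by (metis Ints_cases add.commute diff_add_cancel dist_nearest_int_shift)

lemma dist_nearest_int_triangle:
  "dist_nearest_int (x + y) \<le> dist_nearest_int x + dist_nearest_int y"
  using dist_nearest_int_le[of "x + y" "round x + round y"] by (simp add: dist_nearest_int_def)

lemma dist_nearest_int_minus: "dist_nearest_int (- x) = dist_nearest_int x"
  using dist_nearest_int_le[of "- x" "- round x"] dist_nearest_int_le[of x "- round (- x)"]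
  by (simp add: dist_nearest_int_def)

lemma dist_nearest_int_eq_0: "dist_nearest_int x = 0 \<longleftrightarrow> x \<in> \<int>"
  by (auto simp: dist_nearest_int_def elim!: Ints_cases) (metis Ints_of_int)

quotient_type circle = real / "\<lambda>x y. x - y \<in> \<int>"
proof (rule equivpI)
  show "reflp (\<lambda>x y::real. x - y \<in> \<int>)" by (simp add: reflp_def)
  show "symp (\<lambda>x y::real. x - y \<in> \<int>)"
    by (rule sympI) (metis Ints_minus minus_diff_eq)
  show "transp (\<lambda>x y::real. x - y \<in> \<int>)"
    by (rule transpI) (metis Ints_add diff_add_cancel add_diff_eq)
qed

instantiation circle :: ab_group_add
begin

lift_definition zero_circle :: circle is 0 .

lift_definition plus_circle :: "circle \<Rightarrow> circle \<Rightarrow> circle" is "(+)"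
  by (metis Ints_add add_diff_add)

lift_definition uminus_circle :: "circle \<Rightarrow> circle" is uminus
  by (metis Ints_minus minus_diff_minus)

lift_definition minus_circle :: "circle \<Rightarrow> circle \<Rightarrow> circle" is "(-)"
  by (smt (verit) Ints_diff)

instance
  by standard (transfer; simp add: algebra_simps)+

end

lift_definition circle_multiple :: "nat \<Rightarrow> circle \<Rightarrow> circle" is "\<lambda>n x. real n * x"
  by (metis Ints_mult Ints_of_nat right_diff_distrib)

lemma circle_multiple_0: "circle_multiple 0 x = 0"
  by transfer simp

lemma circle_multiple_Suc: "circle_multiple (Suc n) x = x + circle_multiple n x"
  by transfer (simp add: algebra_simps)

lift_definition circle_norm :: "circle \<Rightarrow> real" is dist_nearest_int
  by (rule dist_nearest_int_cong)

instantiation circle :: metric_space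
begin

definition dist_circle :: "circle \<Rightarrow> circle \<Rightarrow> real" where
  "dist_circle x y = circle_norm (x - y)"

definition uniformity_circle :: "(circle \<times> circle) filter" where
  "uniformity_circle = (INF e\<in>{0<..}. principal {(x, y). dist x y < e})"

definition open_circle :: "circle set \<Rightarrow> bool" where
  "open_circle U \<longleftrightarrow> (\<forall>x\<in>U. \<forall>\<^sub>F (x', y) in uniformity. x' = x \<longrightarrow> y \<in> U)"

instance
proof
  fix x y z :: circle
  show "dist x y = 0 \<longleftrightarrow> x = y"
    unfolding dist_circle_def by transfer (rule dist_nearest_int_eq_0)
  show "dist x y \<le> dist x z + dist y z"
    unfolding dist_circle_def
  proof transfer
    fix x y z :: real
    show "dist_nearest_int (x - y) \<le> dist_nearest_int (x - z) + dist_nearest_int (y - z)"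
      using dist_nearest_int_triangle[of "x - z" "z - y"] dist_nearest_int_minus[of "y - z"] by simp
  qed
qed (simp_all only: uniformity_circle_def open_circle_def)

end

definition upper_density :: "nat set \<Rightarrow> ereal" where
  "upper_density A = limsup (\<lambda>n. ereal (real (card (A \<inter> {0..<n})) / real n))"

definition lower_density :: "nat set \<Rightarrow> ereal" where
  "lower_density A = liminf (\<lambda>n. ereal (real (card (A \<inter> {0..<n})) / real n))"

definition has_natural_density :: "nat set \<Rightarrow> real \<Rightarrow> bool" where
  "has_natural_density A \<delta> \<longleftrightarrow> lower_density A = ereal \<delta> \<and> upper_density A = ereal \<delta>"

definition arithmetic_seq :: "(nat \<Rightarrow> nat) \<Rightarrow> bool" where
  "arithmetic_seq a \<longleftrightarrow> a 0 = 1 \<and> strict_mono a \<and> (\<forall>n. a n dvd a (Suc n))"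

text \<open>Meaningful for \<open>n \<ge> 1\<close>; the division is exact for an arithmetic sequence.\<close>

definition ratio :: "(nat \<Rightarrow> nat) \<Rightarrow> nat \<Rightarrow> nat" where
  "ratio a n = a n div a (n - 1)"

definition multiples_set :: "(nat \<Rightarrow> nat) \<Rightarrow> nat set" where
  "multiples_set a = {r * a k | r k. 1 \<le> r \<and> r < ratio a (k + 1)}"

text \<open>Indexed from \<open>1\<close>, whereas \<^const>\<open>enumerate\<close> counts from \<open>0\<close>.\<close>

definition multiples_seq :: "(nat \<Rightarrow> nat) \<Rightarrow> nat \<Rightarrow> nat" where
  "multiples_seq a n = enumerate (multiples_set a) (n - 1)"

definition subsequence_of ::
    "nat set \<Rightarrow> (nat \<Rightarrow> 'b) \<Rightarrow> nat set \<Rightarrow> (nat \<Rightarrow> 'b) \<Rightarrow> bool" where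
  "subsequence_of I x J y \<longleftrightarrow>
    (\<exists>\<phi>. strict_mono_on I \<phi> \<and> \<phi> ` I \<subseteq> J \<and> (\<forall>i\<in>I. x i = y (\<phi> i)))"

definition arithmetic_type_seq :: "(nat \<Rightarrow> nat) \<Rightarrow> (nat \<Rightarrow> nat) \<Rightarrow> bool" where
  "arithmetic_type_seq a e \<longleftrightarrow>
    strict_mono_on {1..} e \<and>
    subsequence_of {0..} a {1..} e \<and>
    subsequence_of {1..} e {1..} (multiples_seq a)"

definition position :: "(nat \<Rightarrow> nat) \<Rightarrow> (nat \<Rightarrow> nat) \<Rightarrow> nat \<Rightarrow> nat" where
  "position a e k = (THE n. 1 \<le> n \<and> e n = a k)"

definition lifting :: "(nat \<Rightarrow> nat) \<Rightarrow> (nat \<Rightarrow> nat) \<Rightarrow> nat set \<Rightarrow> nat set" where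
  "lifting a e A = (\<Union>k\<in>A. {position a e (k - 1) .. position a e k - 1})"

definition shift_down :: "nat set \<Rightarrow> nat \<Rightarrow> nat set" where
  "shift_down A m = {n. 1 \<le> n \<and> (\<exists>a\<in>A. int n = int a - int m)}"

definition b_divergent :: "(nat \<Rightarrow> nat) \<Rightarrow> nat set \<Rightarrow> bool" where
  "b_divergent a A \<longleftrightarrow>
    infinite A \<and> filterlim (\<lambda>i. ratio a (enumerate A i)) at_top sequentially"

definition strongly_non_L_invariant :: "(nat \<Rightarrow> nat) \<Rightarrow> (nat \<Rightarrow> nat) \<Rightarrow> bool" where
  "strongly_non_L_invariant a e \<longleftrightarrow>
    (\<forall>A\<subseteq>{1..}. b_divergent a A \<longrightarrow> upper_density (lifting a e A) > 0)"

definition weakly_L_invariant :: "(nat \<Rightarrow> nat) \<Rightarrow> (nat \<Rightarrow> nat) \<Rightarrow> bool" where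
  "weakly_L_invariant a e \<longleftrightarrow>
    (\<exists>A\<subseteq>{1..}. infinite A \<and>
      (\<forall>m. has_natural_density (lifting a e (shift_down A m)) 0))"

definition characterized_subgroup :: "(nat \<Rightarrow> nat) \<Rightarrow> circle set" where
  "characterized_subgroup e = {x. (\<lambda>n. circle_multiple (e n) x) \<longlonglongrightarrow> 0}"

definition stat_characterized_subgroup :: "(nat \<Rightarrow> nat) \<Rightarrow> circle set" where
  "stat_characterized_subgroup e =
    {x. \<forall>\<epsilon>>0. has_natural_density {n. 1 \<le> n \<and> circle_norm (circle_multiple (e n) x) \<ge> \<epsilon>} 0}"

end

theory Submission
  imports Defs "HOL-Library.Discrete_Functions" "HOL-Analysis.Abstract_Topology_2"
    "HOL-Real_Asymp.Real_Asymp"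
begin

text \<open>
  Take ratios $b_k = 4^k$, that is $a_k = 2^{k(k+1)}$, and let $(e_n)$ contain in the \<open>k\<close>-th block
  the multiples $r a_{k-1}$ with $1 \le r < 2^k$ or $r = b_k/2$.  The \<open>k\<close>-th block is then at least
  as long as all previous blocks together, so $L(A)$ has upper density at least $1/2$ for every
  infinite \<open>A\<close>; this excludes weak \<open>L\<close>-invariance and gives strong non-\<open>L\<close>-invariance.  On the other
  hand, if $x = \sum_{k \in S} 1/a_k$ then $\|a_{k-1} x\| \le 2/b_k$, so $\|r a_{k-1} x\|$ is
  small for all $r < 2^k$, and only the last index of each block can be exceptional; these indices
  grow exponentially and have density zero.  At the last index, $\|(b_k/2) a_{k-1} x\|$ is close to
  $1/2$ or to $0$ according to whether $k \in S$, so for infinite \<open>S\<close> there is no convergence, and \<open>S\<close>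
  can be recovered from \<open>x\<close>.
\<close>

section \<open>Densities\<close>

lemma upper_density_ge_frequently:
  assumes "\<exists>\<^sub>F n in sequentially. c \<le> real (card (A \<inter> {0..<n})) / real n"
  shows "ereal c \<le> upper_density A"
proof (rule ccontr)
  assume "\<not> ereal c \<le> upper_density A"
  then have "Limsup sequentially (\<lambda>n. ereal (real (card (A \<inter> {0..<n})) / real n)) < ereal c"
    by (simp add: upper_density_def not_le)
  then have "\<forall>\<^sub>F n in sequentially. ereal (real (card (A \<inter> {0..<n})) / real n) < ereal c"
    by (rule Limsup_lessD)
  then show False
    using assms by (simp add: frequently_def not_le)
qed

lemma has_natural_density_tendsto:
  assumes "(\<lambda>n. real (card (A \<inter> {0..<n})) / real n) \<longlonglongrightarrow> \<delta>"
  shows "has_natural_density A \<delta>"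
  using assms unfolding has_natural_density_def lower_density_def upper_density_def
  by (auto intro!: lim_imp_Limsup lim_imp_Liminf)

text \<open>If \<open>g m < n\<close> then \<open>m\<close> is at most the binary logarithm of
  \<open>n\<close>, so below \<open>n\<close> the set has at most
  \<open>card F + log 2 n + 1\<close> elements, which is o(n).\<close>

lemma density_zero_exponential:
  assumes fin: "finite F" and sub: "A \<subseteq> F \<union> range g" and g: "\<And>m. 2 ^ m \<le> g m"
  shows "has_natural_density A 0"
proof (rule has_natural_density_tendsto)
  let ?c = "real (card F)"
  have bound: "real (card (A \<inter> {0..<n})) \<le> ?c + log 2 n + 1" if "n > 0" for n :: nat
  proof -
    have "A \<inter> {0..<n} \<subseteq> F \<union> g ` {..floor_log n}"
    proof
      fix k assume k: "k \<in> A \<inter> {0..<n}"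
      show "k \<in> F \<union> g ` {..floor_log n}"
      proof (cases "k \<in> F")
        case False
        with k sub obtain m where m: "k = g m" by blast
        have "2 ^ m \<le> n" using k m g[of m] by auto
        then have "m \<le> floor_log n" using floor_log_le_iff[of "2 ^ m" n] by simp
        then show ?thesis using m by auto
      qed auto
    qed
    then have "card (A \<inter> {0..<n}) \<le> card (F \<union> g ` {..floor_log n})"
      using fin by (intro card_mono) auto
    also have "\<dots> \<le> card F + card (g ` {..floor_log n})" by (rule card_Un_le)
    also have "\<dots> \<le> card F + Suc (floor_log n)"
      using card_image_le[of "{..floor_log n}" g] by simp
    finally have c: "card (A \<inter> {0..<n}) \<le> card F + Suc (floor_log n)" .
    have "real (2 ^ floor_log n) \<le> real n"
      using floor_log_exp2_le[OF that] of_nat_le_iff by blast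
    then have "real (floor_log n) \<le> log 2 n"
      using that by (simp add: le_log_iff powr_realpow)
    with c show ?thesis by linarith
  qed
  have "(\<lambda>n::nat. (?c + log 2 n + 1) / real n) \<longlonglongrightarrow> 0" by real_asymp
  then show "(\<lambda>n. real (card (A \<inter> {0..<n})) / real n) \<longlonglongrightarrow> 0"
    by (rule tendsto_sandwich[rotated 2, OF tendsto_const])
      (auto intro!: eventually_sequentiallyI[of 1] divide_right_mono bound simp: Suc_le_eq)
qed

section \<open>Enumerations\<close>

lemma subsequence_of_multiples_seq:
  assumes e: "strict_mono_on {1..} e" and mem: "\<And>n. n \<ge> 1 \<Longrightarrow> e n \<in> multiples_set a"
  shows "subsequence_of {1..} e {1..} (multiples_seq a)"
proof -
  let ?D = "multiples_set a"
  have "inj_on e {1..}" by (rule strict_mono_on_imp_inj_on[OF e])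
  then have "infinite (e ` {1..})" by (simp add: finite_image_iff infinite_Ici)
  then have inf: "infinite ?D" by (rule infinite_super[rotated]) (use mem in auto)
  have "\<exists>i. enumerate ?D i = e n" if "n \<ge> 1" for n
    using range_enumerate[OF inf] mem[OF that] by (metis rangeE)
  then obtain h where h: "\<And>n. n \<ge> 1 \<Longrightarrow> enumerate ?D (h n) = e n" by metis
  have "h n < h m" if "n \<ge> 1" "m \<ge> 1" "n < m" for n m
  proof -
    have "enumerate ?D (h n) < enumerate ?D (h m)"
      using h strict_mono_onD[OF e, of n m] that by auto
    then show ?thesis using strict_mono_less[OF strict_mono_enumerate[OF inf]] by blast
  qed
  \<comment> \<open>\<open>Suc\<close> translates positions of \<open>enumerate\<close>, counted
    from 0, into indices of \<open>multiples_seq\<close>, counted from 1.\<close>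
  then show ?thesis unfolding subsequence_of_def multiples_seq_def
    by (intro exI[of _ "\<lambda>n. Suc (h n)"]) (auto simp: strict_mono_on_def h)
qed

section \<open>The sequences\<close>

text \<open>The exponent is 2 + 4 + ... + 2k, so the value is the product of the ratios 4^1, ...,
  4^k.\<close>

definition block_base :: "nat \<Rightarrow> nat" where
  "block_base k = 2 ^ (k * (k + 1))"

text \<open>The indices \<open>n\<close> of the block of multiples of \<open>block_base m\<close> are those with
  \<open>2 ^ (m + 1) \<le> n + 1 < 2 ^ (m + 2)\<close>.\<close>

definition block_seq :: "nat \<Rightarrow> nat" where
  "block_seq n = (let m = floor_log (n + 1) - 1 in
     (if n + 2 = 2 ^ (m + 2) then 2 ^ (2 * m + 1) else n + 2 - 2 ^ (m + 1)) * block_base m)"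

lemma block_base_Suc: "block_base (Suc k) = 4 ^ Suc k * block_base k"
proof -
  have "Suc k * (Suc k + 1) = 2 * Suc k + k * (k + 1)" by simp
  then have "block_base (Suc k) = 2 ^ (2 * Suc k) * block_base k"
    unfolding block_base_def by (simp only: power_add)
  then show ?thesis by (simp only: power_mult) simp
qed

lemma block_base_pos: "block_base k > 0"
  by (simp add: block_base_def)

lemma arithmetic_seq_block_base: "arithmetic_seq block_base"
  unfolding arithmetic_seq_def strict_mono_Suc_iff
proof (intro conjI allI)
  fix n
  have "(4::nat) ^ Suc n > 1" by (rule one_less_power) auto
  then show "block_base n < block_base (Suc n)"
    using block_base_pos[of n] by (simp add: block_base_Suc)
qed (simp_all add: block_base_Suc, simp add: block_base_def)

lemma ratio_block_base: "ratio block_base (k + 1) = 4 ^ (k + 1)"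
  using block_base_pos[of k] by (simp add: ratio_def block_base_Suc del: power_Suc)

section \<open>Values of the sequence inside a block\<close>

lemma floor_log_eqI:
  assumes "2 ^ m \<le> n" "n < 2 ^ Suc m"
  shows "floor_log n = m"
proof (rule antisym)
  have "n > 0" using assms(1) by (metis gr0I le_zero_eq power_not_zero zero_neq_numeral)
  then have "2 ^ floor_log n < (2 :: nat) ^ Suc m"
    using floor_log_exp2_le[of n] assms(2) by linarith
  then have "floor_log n < Suc m" by (simp only: power_strict_increasing_iff)
  then show "floor_log n \<le> m" by simp
  show "m \<le> floor_log n" using floor_log_le_iff[OF assms(1)] by simp
qed

text \<open>Offsets \<open>j\<close> count from the start of the block. The hypothesis stops one
  short of the end, where the multiplier jumps to half the ratio 4^(m+1).\<close>

lemma block_seq_regular: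
  assumes "j + 1 < 2 ^ (m + 1)"
  shows "block_seq (2 ^ (m + 1) - 1 + j) = (j + 1) * block_base m"
proof -
  have "floor_log (2 ^ (m + 1) - 1 + j + 1) = m + 1"
    by (rule floor_log_eqI) (use assms in auto)
  moreover have "2 ^ (m + 1) - 1 + j + 2 \<noteq> 2 ^ (m + 2)"
    using assms by simp
  moreover have "2 ^ (m + 1) - 1 + j + 2 - 2 ^ (m + 1) = j + 1" by simp
  ultimately show ?thesis by (simp add: block_seq_def Let_def)
qed

lemma block_seq_last: "block_seq (2 ^ (m + 2) - 2) = 2 ^ (2 * m + 1) * block_base m"
proof -
  \<comment> \<open>Ensures that the natural-number subtraction in \<open>2 ^ (m + 2) - 2\<close>
    does not truncate.\<close>
  have ge: "(2::nat) \<le> 2 ^ (m + 1)" using one_le_power[of "2::nat" m] by simp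
  have "2 ^ (m + 1) \<le> 2 ^ (m + 2) - 2 + (1::nat)" "2 ^ (m + 2) - 2 + 1 < (2::nat) ^ Suc (m + 1)"
    using ge by (simp_all only: add_2_eq_Suc' Suc_eq_plus1[symmetric] power_Suc)
  then have "floor_log (2 ^ (m + 2) - 2 + 1) = m + 1" by (rule floor_log_eqI)
  moreover have "2 ^ (m + 2) - 2 + 2 = (2::nat) ^ (m + 2)"
    using ge by (simp only: add_2_eq_Suc' Suc_eq_plus1[symmetric] power_Suc)
  ultimately show ?thesis by (simp add: block_seq_def Let_def)
qed

text \<open>The binary length of \<open>n + 1\<close> determines the block. This case split serves
  monotonicity, membership among the multiples, and the norm estimates.\<close>

lemma block_index_cases:
  fixes n :: nat
  assumes "n \<ge> 1"
  obtains (regular) m j where "j + 1 < 2 ^ (m + 1)" "n = 2 ^ (m + 1) - 1 + j"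
    | (last) m where "n = 2 ^ (m + 2) - 2"
proof -
  define m where "m = floor_log (n + 1) - 1"
  have "floor_log (n + 1) \<ge> 1"
    using floor_log_le_iff[of "2 ^ 1" "n + 1"] assms unfolding floor_log_power by simp
  then have m: "floor_log (n + 1) = m + 1" by (simp add: m_def)
  have lo: "2 ^ (m + 1) \<le> n + 1" using floor_log_exp2_le[of "n + 1"] m by simp
  have hi: "n + 1 < 2 * 2 ^ (m + 1)" using floor_log_exp2_gt[of "n + 1"] m by simp
  show thesis
  proof (cases "n + 2 = 2 ^ (m + 2)")
    case True
    then have "n = 2 ^ (m + 2) - 2" by simp
    then show thesis by (rule last)
  next
    case False
    with lo hi show thesis by (intro regular[of "n + 1 - 2 ^ (m + 1)" m]) auto
  qed
qed

lemma block_seq_start: "block_seq (2 ^ (k + 1) - 1) = block_base k"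
  using block_seq_regular[of 0 k] one_less_power[of "2::nat" "k + 1"] by simp

lemma block_seq_less_Suc:
  assumes "n \<ge> 1"
  shows "block_seq n < block_seq (Suc n)"
  using assms
proof (cases rule: block_index_cases)
  case (regular m j)
  show ?thesis
  proof (cases "j + 2 < 2 ^ (m + 1)")
    case True
    then show ?thesis
      using block_seq_regular[of j m] block_seq_regular[of "j + 1" m] regular block_base_pos[of m]
      by simp
  next
    case False
    \<comment> \<open>The jump inside a block: the multiplier goes from
      \<open>2 ^ (m + 1) - 1\<close> to \<open>2 ^ (2 * m + 1)\<close>. The case \<open>last\<close>
      below passes to the next block, where the multiplier would be the full ratio.\<close>
    then have j: "j + 2 = 2 ^ (m + 1)" using regular by simp
    then have s: "Suc n = 2 ^ (m + 2) - 2" using regular by simp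
    have "(2::nat) ^ (m + 1) \<le> 2 ^ (2 * m + 1)" by (rule power_increasing) auto
    then have "j + 1 < 2 ^ (2 * m + 1)" using j by linarith
    then show ?thesis
      unfolding s block_seq_last unfolding regular(2) block_seq_regular[OF regular(1)]
      using block_base_pos[of m] by (rule mult_strict_right_mono)
  qed
next
  case (last m)
  have "(2::nat) \<le> 2 ^ (m + 2)" using one_less_power[of "2::nat" "m + 2"] by linarith
  then have "Suc n = 2 ^ (m + 2) - 1" using last by linarith
  then have s: "Suc n = 2 ^ (Suc m + 1) - 1" by simp
  have "(4::nat) ^ Suc m = 2 * 2 ^ (2 * m + 1)" by (simp add: power_mult)
  moreover have "(2::nat) ^ (2 * m + 1) > 0" by simp
  ultimately have "(2::nat) ^ (2 * m + 1) < 4 ^ Suc m" by linarith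
  then show ?thesis
    unfolding s block_seq_start unfolding last block_seq_last block_base_Suc
    using block_base_pos[of m] by (rule mult_strict_right_mono)
qed

lemma strict_mono_on_block_seq: "strict_mono_on {1..} block_seq"
proof -
  have "strict_mono (\<lambda>n. block_seq (Suc n))"
    by (simp add: strict_mono_Suc_iff block_seq_less_Suc)
  then have "block_seq (Suc (r - 1)) < block_seq (Suc (s - 1))" if "1 \<le> r" "r < s" for r s
    by (rule strict_monoD) (use that in linarith)
  then show ?thesis by (simp add: strict_mono_on_def)
qed

lemma block_seq_in_multiples_set:
  assumes "n \<ge> 1"
  shows "block_seq n \<in> multiples_set block_base"
proof -
  have "\<exists>r m. block_seq n = r * block_base m \<and> 1 \<le> r \<and> r < 4 ^ (m + 1)"
    using assms
  proof (cases rule: block_index_cases)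
    case (regular m j)
    have "(2::nat) ^ (m + 1) \<le> 4 ^ (m + 1)" by (rule power_mono) auto
    then have "j + 1 < 4 ^ (m + 1)" using regular by linarith
    then show ?thesis using block_seq_regular[of j m] regular by (metis le_add2)
  next
    case (last m)
    have "(4::nat) ^ (m + 1) = 2 * 2 ^ (2 * m + 1)" by (simp add: power_mult)
    moreover have "(2::nat) ^ (2 * m + 1) > 0" by simp
    ultimately have "(2::nat) ^ (2 * m + 1) < 4 ^ (m + 1)" "(1::nat) \<le> 2 ^ (2 * m + 1)"
      by linarith+
    then show ?thesis unfolding last block_seq_last by blast
  qed
  then show ?thesis by (auto simp: multiples_set_def ratio_block_base[simplified])
qed

lemma arithmetic_type_block_seq: "arithmetic_type_seq block_base block_seq"
  unfolding arithmetic_type_seq_def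
proof (intro conjI)
  have "strict_mono (\<lambda>k. 2 ^ (k + 1) - 1 :: nat)"
    by (simp add: strict_mono_Suc_iff diff_less_mono2 less_diff_conv)
  moreover have "1 \<le> (2 ^ (k + 1) - 1 :: nat)" for k
    using one_less_power[of "2::nat" "k + 1"] by simp
  ultimately show "subsequence_of {0..} block_base {1..} block_seq"
    unfolding subsequence_of_def
    by (intro exI[of _ "\<lambda>k. 2 ^ (k + 1) - 1"] conjI ballI image_subsetI block_seq_start[symmetric])
      (simp_all only: strict_mono_on_def strict_mono_def atLeast_iff UNIV_I le0 simp_thms)
qed (intro strict_mono_on_block_seq subsequence_of_multiples_seq block_seq_in_multiples_set)+

section \<open>Lifted sets\<close>

lemma position_block: "position block_base block_seq k = 2 ^ (k + 1) - 1"
  unfolding position_def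
proof (rule the_equality)
  have one: "(1::nat) \<le> 2 ^ (k + 1) - 1" using one_less_power[of "2::nat" "k + 1"] by simp
  then show "1 \<le> (2 ^ (k + 1) - 1 :: nat) \<and> block_seq (2 ^ (k + 1) - 1) = block_base k"
    by (simp only: block_seq_start)
  fix n assume "1 \<le> n \<and> block_seq n = block_base k"
  then show "n = 2 ^ (k + 1) - 1"
    using inj_onD[OF strict_mono_on_imp_inj_on[OF strict_mono_on_block_seq], of n "2 ^ (k + 1) - 1"]
      one block_seq_start[of k] by simp
qed

text \<open>For \<open>k\<close> in \<open>A\<close> the lifted set fills the indices from 2^k - 1
  to 2^(k+1) - 2, which are 2^k of the first 2^(k+1) - 1 numbers, hence more than half.\<close>

lemma upper_density_lifting_block:
  assumes A: "A \<subseteq> {1..}" "infinite A"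
  shows "upper_density (lifting block_base block_seq A) \<ge> ereal (1 / 2)"
proof (rule upper_density_ge_frequently)
  let ?L = "lifting block_base block_seq A"
  have dense: "1 / 2 \<le> real (card (?L \<inter> {0..<2 ^ (k + 1) - 1})) / real (2 ^ (k + 1) - 1)"
    if k: "k \<in> A" for k
  proof -
    \<comment> \<open>Positivity of \<open>k\<close> makes \<open>k - 1\<close> in
      \<open>lifting\<close> a true predecessor.\<close>
    obtain m where m: "k = Suc m" using k A by (cases k) auto
    have "{2 ^ k - 1 .. 2 ^ (k + 1) - 1 - 1} \<subseteq> ?L"
      unfolding lifting_def using k m by (auto simp: position_block)
    moreover have "(1::nat) \<le> 2 ^ k" by simp
    ultimately have "{2 ^ k - 1 ..< 2 ^ (k + 1) - 1} \<subseteq> ?L \<inter> {0..<2 ^ (k + 1) - 1}"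
      by (auto simp: subset_iff)
    then have "card {2 ^ k - 1 ..< 2 ^ (k + 1) - 1 :: nat} \<le> card (?L \<inter> {0..<2 ^ (k + 1) - 1})"
      by (intro card_mono) auto
    then have "2 ^ k \<le> card (?L \<inter> {0..<2 ^ (k + 1) - 1})" by simp
    then have c: "2 ^ k \<le> real (card (?L \<inter> {0..<2 ^ (k + 1) - 1}))"
      by (metis of_nat_le_iff of_nat_numeral of_nat_power)
    have p: "real (2 ^ (k + 1) - 1) = 2 * 2 ^ k - 1" by (simp add: of_nat_diff)
    have "(1::real) \<le> 2 ^ k" by simp
    then have "(0::real) < 2 * 2 ^ k - 1" by linarith
    moreover have "1 / 2 * (2 * x - 1) \<le> y" if "x \<le> y" for x y :: real
      using that by (simp add: algebra_simps)
    ultimately show ?thesis unfolding p using c by (simp only: pos_le_divide_eq)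
  qed
  show "\<exists>\<^sub>F n in sequentially. 1 / 2 \<le> real (card (?L \<inter> {0..<n})) / real n"
    unfolding frequently_sequentially
  proof
    fix N
    obtain k where k: "k \<in> A" "k > N" using A(2) infinite_nat_iff_unbounded by blast
    have "k + 1 < 2 ^ (k + 1)" by (rule less_exp)
    then have "N \<le> 2 ^ (k + 1) - 1" using k by linarith
    then show "\<exists>n\<ge>N. 1 / 2 \<le> real (card (?L \<inter> {0..<n})) / real n"
      using dense[OF k(1)] by blast
  qed
qed

lemma strongly_non_L_invariant_block: "strongly_non_L_invariant block_base block_seq"
  unfolding strongly_non_L_invariant_def b_divergent_def
proof (intro allI impI)
  fix A :: "nat set"
  assume "A \<subseteq> {1..}"
    and "infinite A \<and> filterlim (\<lambda>i. ratio block_base (enumerate A i)) at_top sequentially"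
  then have "ereal (1 / 2) \<le> upper_density (lifting block_base block_seq A)"
    by (intro upper_density_lifting_block) auto
  moreover have "0 < ereal (1 / 2)" by simp
  ultimately show "0 < upper_density (lifting block_base block_seq A)" by order
qed

text \<open>The shift by 0 already gives a contradiction: it fixes every set of positive integers,
  and lifts of infinite sets have upper density at least 1/2.\<close>

lemma not_weakly_L_invariant_block: "\<not> weakly_L_invariant block_base block_seq"
proof
  assume "weakly_L_invariant block_base block_seq"
  then obtain A where A: "A \<subseteq> {1..}" "infinite A"
    and "has_natural_density (lifting block_base block_seq (shift_down A 0)) 0"
    by (auto simp: weakly_L_invariant_def)
  moreover have "shift_down A 0 = A" using A by (auto simp: shift_down_def)
  ultimately have "upper_density (lifting block_base block_seq A) = ereal 0"
    by (simp add: has_natural_density_def)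
  with upper_density_lifting_block[OF A] show False by simp
qed

section \<open>Points with prescribed digits\<close>

definition digit_term :: "nat set \<Rightarrow> nat \<Rightarrow> real" where
  "digit_term S k = of_bool (k \<in> S) / real (block_base k)"

text \<open>A representative modulo 1 of \<open>block_base m\<close> times the full series, whose
  terms up to index \<open>m\<close> become integers.\<close>

definition digit_tail :: "nat set \<Rightarrow> nat \<Rightarrow> real" where
  "digit_tail S m = real (block_base m) * (\<Sum>i. digit_term S (i + Suc m))"

lemma digit_term_nonneg: "0 \<le> digit_term S k"
  by (simp add: digit_term_def)

text \<open>The first ratio is kept exactly and each later one is bounded below by 4, which compares
  digit tails with a geometric series.\<close>

lemma block_base_growth: "block_base m * 4 ^ Suc m * 4 ^ i \<le> block_base (i + Suc m)"
proof (induction i)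
  case (Suc i)
  have "block_base m * 4 ^ Suc m * 4 ^ Suc i \<le> 4 * block_base (i + Suc m)"
    using Suc by (simp add: mult_ac)
  also have "\<dots> \<le> 4 ^ Suc (i + Suc m) * block_base (i + Suc m)" by simp
  finally show ?case by (simp add: block_base_Suc)
qed (simp add: block_base_Suc)

lemma digit_term_le:
  "real (block_base m) * digit_term S (i + Suc m) \<le> 1 / 4 ^ Suc m * (1 / 4) ^ i"
proof -
  have "real (block_base m * 4 ^ Suc m * 4 ^ i) \<le> real (block_base (i + Suc m))"
    using block_base_growth of_nat_le_iff by blast
  then have "real (block_base m) * 4 ^ Suc m * 4 ^ i \<le> real (block_base (i + Suc m))"
    by simp
  then have "real (block_base m) / real (block_base (i + Suc m)) \<le> 1 / (4 ^ Suc m * 4 ^ i)"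
    using block_base_pos[of "i + Suc m"] by (simp add: field_simps)
  moreover have "real (block_base m) * digit_term S (i + Suc m)
      \<le> real (block_base m) / real (block_base (i + Suc m))"
    by (simp add: digit_term_def)
  ultimately show ?thesis by (simp add: power_one_over)
qed

lemma summable_digit_term: "summable (digit_term S)"
proof -
  have "digit_term S (i + 1) \<le> (1 / 4) ^ i" for i
    using digit_term_le[of 0 S i] digit_term_nonneg[of S "Suc i"] by (simp add: block_base_def)
  then have "summable (\<lambda>i. digit_term S (i + 1))"
    by (intro summable_comparison_test[OF _ summable_geometric[of "1 / 4 :: real"]])
      (auto simp: digit_term_nonneg)
  then show ?thesis by (simp only: summable_iff_shift)
qed

lemma digit_tail_nonneg: "0 \<le> digit_tail S m"
  unfolding digit_tail_def
  by (intro mult_nonneg_nonneg suminf_nonneg summable_ignore_initial_segment summable_digit_term)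
    (auto simp: digit_term_nonneg)

lemma digit_tail_le: "digit_tail S m \<le> 2 / 4 ^ Suc m"
proof -
  have s: "summable (\<lambda>i. digit_term S (i + Suc m))"
    by (rule summable_ignore_initial_segment[OF summable_digit_term])
  have g: "summable (\<lambda>i. 1 / 4 ^ Suc m * (1 / 4 :: real) ^ i)"
    by (intro summable_mult summable_geometric) simp
  have "digit_tail S m = (\<Sum>i. real (block_base m) * digit_term S (i + Suc m))"
    unfolding digit_tail_def by (rule suminf_mult[OF s, symmetric])
  also have "\<dots> \<le> (\<Sum>i. 1 / 4 ^ Suc m * (1 / 4) ^ i)"
    by (rule suminf_le[OF digit_term_le summable_mult[OF s] g])
  also have "\<dots> = 1 / 4 ^ Suc m * (4 / 3)"
    by (subst suminf_mult) (auto simp: suminf_geometric summable_geometric)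
  \<comment> \<open>The geometric factor 4/3 is rounded up to 2.\<close>
  also have "\<dots> \<le> 2 / 4 ^ Suc m" by (simp add: field_simps)
  finally show ?thesis .
qed

text \<open>The digit shift: multiplying by the next ratio turns the leading term into the digit at
  \<open>Suc m\<close> and the remainder into the next tail.\<close>

lemma digit_tail_Suc:
  "4 ^ Suc m * digit_tail S m = of_bool (Suc m \<in> S) + digit_tail S (Suc m)"
proof -
  have "(\<Sum>i. digit_term S (i + Suc m))
      = (\<Sum>i. digit_term S (Suc i + Suc m)) + digit_term S (Suc m)"
    using suminf_split_head[OF summable_ignore_initial_segment[OF summable_digit_term], of S "Suc m"]
    by simp
  moreover have "4 ^ Suc m * real (block_base m) = real (block_base (Suc m))"
    by (simp add: block_base_Suc)
  ultimately show ?thesis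
    using block_base_pos[of "Suc m"]
    unfolding digit_tail_def mult.assoc[symmetric] by (simp add: digit_term_def distrib_left)
qed

section \<open>Norms of multiples of a digit point\<close>

definition digit_point :: "nat set \<Rightarrow> circle" where
  "digit_point S = abs_circle (suminf (digit_term S))"

lemma norm_multiple_digit_point:
  "circle_norm (circle_multiple (r * block_base m) (digit_point S))
    = dist_nearest_int (real r * digit_tail S m)"
proof -
  have "real (block_base m) * digit_term S k \<in> \<int>" if "k < Suc m" for k
  proof -
    have "block_base k dvd block_base m"
      unfolding block_base_def using that by (intro le_imp_power_dvd mult_mono) auto
    then obtain c where "block_base m = block_base k * c" by (rule dvdE)
    then show ?thesis using block_base_pos[of k] by (simp add: digit_term_def)
  qed
  then have "(\<Sum>k<Suc m. real (block_base m) * digit_term S k) \<in> \<int>" by (intro Ints_sum) auto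
  then have "real r * (\<Sum>k<Suc m. real (block_base m) * digit_term S k) \<in> \<int>" by simp
  moreover have "real (r * block_base m) * suminf (digit_term S) - real r * digit_tail S m
      = real r * (\<Sum>k<Suc m. real (block_base m) * digit_term S k)"
    unfolding suminf_split_initial_segment[OF summable_digit_term, of S "Suc m"]
      sum_distrib_left[symmetric] digit_tail_def
    by (simp add: algebra_simps)
  ultimately have "real (r * block_base m) * suminf (digit_term S) - real r * digit_tail S m \<in> \<int>"
    by simp
  then show ?thesis
    unfolding digit_point_def circle_multiple.abs_eq circle_norm.abs_eq
    by (rule dist_nearest_int_cong)
qed

text \<open>A multiplier below 2^(m+1) meets a tail of size at most 2/4^(m+1), and the product is at
  most 2^(-m).\<close>

lemma norm_regular_le:
  assumes "j + 1 < 2 ^ (m + 1)"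
  shows "circle_norm (circle_multiple (block_seq (2 ^ (m + 1) - 1 + j)) (digit_point S))
    \<le> (1 / 2) ^ m"
proof -
  have "real (j + 1) \<le> real (2 ^ (m + 1))" using assms by (simp only: of_nat_le_iff)
  then have "real (j + 1) * digit_tail S m \<le> 2 ^ (m + 1) * (2 / 4 ^ Suc m)"
    using digit_tail_le[of S m] digit_tail_nonneg[of S m] by (intro mult_mono) auto
  also have "\<dots> = (1 / 2) ^ m"
  proof -
    have "(4::real) ^ Suc m = 2 ^ (m + 1) * 2 ^ (m + 1)"
      by (simp flip: power_mult_distrib)
    then show ?thesis by (simp add: power_one_over)
  qed
  finally have "real (j + 1) * digit_tail S m \<le> (1 / 2) ^ m" .
  moreover have "0 \<le> real (j + 1) * digit_tail S m" using digit_tail_nonneg by simp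
  ultimately show ?thesis
    unfolding block_seq_regular[OF assms] norm_multiple_digit_point
    using dist_nearest_int_le[of "real (j + 1) * digit_tail S m" 0] by simp
qed

lemma dist_nearest_int_ge:
  assumes "1 / 4 \<le> x" "x \<le> 3 / 4"
  shows "1 / 4 \<le> dist_nearest_int x"
proof (cases "round x \<le> 0")
  case True
  then have "real_of_int (round x) \<le> 0" by simp
  with assms show ?thesis unfolding dist_nearest_int_def by linarith
next
  case False
  then have "1 \<le> real_of_int (round x)" by linarith
  with assms show ?thesis unfolding dist_nearest_int_def by linarith
qed

text \<open>By the digit shift, half the ratio times the tail is half of the digit plus half of the
  next tail. The next tail is at most 1/8, so this lies in [1/2, 9/16] or in [0, 1/16], and the
  threshold 1/4 reads off the digit.\<close>

lemma norm_last_iff: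
  "circle_norm (circle_multiple (block_seq (2 ^ (m + 2) - 2)) (digit_point S)) \<ge> 1 / 4
    \<longleftrightarrow> Suc m \<in> S"
proof -
  let ?t = "digit_tail S (Suc m)"
  have "real (2 ^ (2 * m + 1)) * digit_tail S m = 4 ^ Suc m * digit_tail S m / 2"
    by (simp add: power_mult)
  then have eq: "real (2 ^ (2 * m + 1)) * digit_tail S m = of_bool (Suc m \<in> S) / 2 + ?t / 2"
    unfolding digit_tail_Suc by (simp add: add_divide_distrib)
  have "(4::real) ^ 2 \<le> 4 ^ Suc (Suc m)" by (rule power_increasing) auto
  then have "2 / 4 ^ Suc (Suc m) \<le> (2 :: real) / 4 ^ 2" by (intro divide_left_mono) auto
  also have "\<dots> = 1 / 8" by simp
  finally have t: "0 \<le> ?t" "?t \<le> 1 / 8"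
    using digit_tail_le[of S "Suc m"] digit_tail_nonneg[of S "Suc m"] by linarith+
  show ?thesis
    unfolding block_seq_last norm_multiple_digit_point eq
  proof (cases "Suc m \<in> S")
    case True
    with t show "1 / 4 \<le> dist_nearest_int (of_bool (Suc m \<in> S) / 2 + ?t / 2) \<longleftrightarrow> Suc m \<in> S"
      using dist_nearest_int_ge[of "1 / 2 + ?t / 2"] by simp
  next
    case False
    with t show "1 / 4 \<le> dist_nearest_int (of_bool (Suc m \<in> S) / 2 + ?t / 2) \<longleftrightarrow> Suc m \<in> S"
      using dist_nearest_int_le[of "?t / 2" 0] by simp
  qed
qed

section \<open>Membership in the two subgroups\<close>

lemma digit_point_in_stat: "digit_point S \<in> stat_characterized_subgroup block_seq"
  unfolding stat_characterized_subgroup_def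
proof (intro CollectI allI impI)
  fix \<epsilon> :: real assume "\<epsilon> > 0"
  then obtain M where M: "(1 / 2) ^ M < \<epsilon>"
    using real_arch_pow_inv[of \<epsilon> "1 / 2"] by auto
  let ?E = "{n. 1 \<le> n \<and> \<epsilon> \<le> circle_norm (circle_multiple (block_seq n) (digit_point S))}"
  \<comment> \<open>From block \<open>M\<close> on, regular indices have norm below \<epsilon>. The
    initial segment covers the earlier blocks, and the range collects all last indices.\<close>
  have "?E \<subseteq> {..<2 ^ (M + 2)} \<union> range (\<lambda>m. 2 ^ (m + 2) - 2)"
  proof
    fix n assume n: "n \<in> ?E"
    then have "n \<ge> 1" by simp
    then show "n \<in> {..<2 ^ (M + 2)} \<union> range (\<lambda>m. 2 ^ (m + 2) - 2)"
    proof (cases rule: block_index_cases)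
      case (regular m j)
      have "m < M"
      proof (rule ccontr)
        assume "\<not> m < M"
        then have "(1 / 2 :: real) ^ m \<le> (1 / 2) ^ M" by (intro power_decreasing) auto
        with norm_regular_le[OF regular(1), of S] n M regular(2) show False by simp
      qed
      then have "(2::nat) ^ (m + 2) \<le> 2 ^ (M + 2)" by (intro power_increasing) auto
      moreover have "n < 2 ^ (m + 2)" using regular by simp
      ultimately have "n < 2 ^ (M + 2)" by linarith
      then show ?thesis by simp
    qed auto
  qed
  then show "has_natural_density ?E 0"
  proof (rule density_zero_exponential[rotated])
    fix m :: nat
    have "(1::nat) \<le> 2 ^ m" by simp
    then show "(2::nat) ^ m \<le> 2 ^ (m + 2) - 2" by simp
  qed simp
qed

lemma digit_point_not_in_characterized:
  assumes "infinite S"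
  shows "digit_point S \<notin> characterized_subgroup block_seq"
proof
  assume "digit_point S \<in> characterized_subgroup block_seq"
  then have "(\<lambda>n. circle_multiple (block_seq n) (digit_point S)) \<longlonglongrightarrow> 0"
    by (simp add: characterized_subgroup_def)
  from metric_LIMSEQ_D[OF this, of "1 / 4"]
  obtain N where N: "\<forall>n\<ge>N. circle_norm (circle_multiple (block_seq n) (digit_point S)) < 1 / 4"
    by (auto simp: dist_circle_def)
  obtain k where k: "k \<in> S" "k > N" using assms infinite_nat_iff_unbounded by blast
  then obtain m where m: "k = Suc m" by (cases k) auto
  \<comment> \<open>Places the last index of the block of \<open>k\<close> beyond \<open>N\<close>,
    since \<open>k > N\<close> means \<open>N \<le> m\<close>.\<close>
  have "m < 2 ^ m" by simp
  moreover have "(2::nat) ^ (m + 2) = 4 * 2 ^ m" by simp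
  ultimately have "N \<le> 2 ^ (m + 2) - 2" using k m by linarith
  with N norm_last_iff[of m S] k m show False by force
qed

section \<open>Cardinality of the difference\<close>

text \<open>The norms at the last indices recover all positive digits. Position 0 is excluded
  because \<open>block_base 0 = 1\<close>, so its term is an integer and vanishes on the
  circle.\<close>

lemma digit_point_eq_iff:
  assumes "S \<subseteq> {1..}" "T \<subseteq> {1..}"
  shows "digit_point S = digit_point T \<longleftrightarrow> S = T"
proof
  assume "digit_point S = digit_point T"
  then have "Suc m \<in> S \<longleftrightarrow> Suc m \<in> T" for m using norm_last_iff[of m] by metis
  moreover have "0 \<notin> S" "0 \<notin> T" using assms by auto
  ultimately have "k \<in> S \<longleftrightarrow> k \<in> T" for k by (cases k) simp_all
  then show "S = T" by blast
qed simp

lemma circle_lepoll_real: "(UNIV :: circle set) \<lesssim> (UNIV :: real set)"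
proof -
  have "(UNIV :: circle set) \<subseteq> range abs_circle"
    by (metis Quotient3_abs_rep Quotient3_circle rangeI subsetI)
  then show ?thesis by (rule subset_image_lepoll)
qed

lemma stat_minus_characterized_eqpoll:
  "stat_characterized_subgroup block_seq - characterized_subgroup block_seq \<approx> (UNIV :: real set)"
    (is "?X \<approx> _")
proof (rule lepoll_antisym)
  show "?X \<lesssim> (UNIV :: real set)"
    by (rule lepoll_trans[OF subset_imp_lepoll[OF subset_UNIV] circle_lepoll_real])
  text \<open>The odd numbers make every digit set infinite.\<close>
  define code :: "nat set \<Rightarrow> nat set"
    where "code R = range (\<lambda>i. 2 * i + 1) \<union> (\<lambda>i. 2 * i + 2) ` R" for R
  have "infinite (range (\<lambda>i::nat. 2 * i + 1))" by (rule range_inj_infinite) (auto simp: inj_on_def)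
  then have "infinite (code R)" for R by (simp add: code_def)
  then have "digit_point (code R) \<in> ?X" for R
    using digit_point_in_stat digit_point_not_in_characterized by blast
  moreover have "inj (\<lambda>R. digit_point (code R))"
  proof (rule injI)
    fix R R' assume eq: "digit_point (code R) = digit_point (code R')"
    have "code Q \<subseteq> {1..}" for Q by (auto simp: code_def)
    with eq have "code R = code R'" using digit_point_eq_iff by blast
    \<comment> \<open>Decoding by parity: the positive even members of the code carry the original
      set.\<close>
    moreover have "i \<in> Q \<longleftrightarrow> 2 * i + 2 \<in> code Q" for i Q
      by (auto simp: code_def Suc_double_not_eq_double)
    ultimately show "R = R'" by blast
  qed
  ultimately have "(UNIV :: nat set set) \<lesssim> ?X"
    unfolding lepoll_def by (intro exI[of _ "\<lambda>R. digit_point (code R)"]) auto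
  then show "(UNIV :: real set) \<lesssim> ?X"
    using nat_sets_eqpoll_reals eqpoll_sym lepoll_trans1 by blast
qed

theorem theorem3p10:
  "\<exists>a e :: nat \<Rightarrow> nat.
    arithmetic_seq a \<and> arithmetic_type_seq a e \<and>
    strongly_non_L_invariant a e \<and>
    \<not> weakly_L_invariant a e \<and>
    stat_characterized_subgroup e - characterized_subgroup e \<approx> (UNIV :: real set)"
  using arithmetic_seq_block_base arithmetic_type_block_seq strongly_non_L_invariant_block
    not_weakly_L_invariant_block stat_minus_characterized_eqpoll by blast

end
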